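(* Let $\mathcal C$ be a join restriction category with local glueings and let $A,B\in\mathcal C$. The source-target span $\sigma_{AB}\colon A\leftarrow\Pi(\mathcal C)_{AB}\rightarrow B\colon\tau_{AB}$ of the Haefliger groupoid of $\mathcal C$ exhibits $\Pi(\mathcal C)_{AB}$ as a product of $A$ and $B$ in the category $\mathrm{Lh}(\mathcal C)$ of local homeomorphisms between objects of $\mathcal C$.
   Context: A restriction category is a category with an operation assigning to each $f\colon A\to B$ a map $\bar f\colon A\to A$ such that $f\bar f=f$; $\bar f\bar g=\bar g\bar f$ and $\overline{g\bar f}=\bar g\bar f$ for $f\colon A\to B$, $g\colon A\to C$; and $\bar g f=f\,\overline{gf}$ for $f\colon A\to B$, $g\colon B\to C$. $\mathcal O(A)$ is the set of restriction idempotents on $A$ (maps $e\colon A\to A$ with $\bar e=e$). A map $f$ is total if $\bar f=1$. For parallel maps, $f\leqslant g$ iff $f=g\bar f$, and $f\smile g$ (compatible) iff $f\bar g=g\bar f$. A join restriction category is a restriction category in which every pairwise-compatible family of parallel maps has a join for $\leqslant$, and these joins are preserved by precomposition. A partial isomorphism is a map $s\colon A\to B$ with a (necessarily unique) partial inverse $s^*\colon B\to A$: $s^*s=\bar s$, $ss^*=\overline{s^*}$. A local homeomorphism is a total map which is a join of partial isomorphisms. $\mathrm{Lh}(\mathcal C)$ is the category with the same objects as $\mathcal C$ and local homeomorphisms as maps. A local atlas on $X$ is a set $I$ and a family $\varphi_{ij}\in\mathcal O(X)$ ($i,j\in I$) with $\varphi_{ij}=\varphi_{ji}$ and $\varphi_{jk}\varphi_{ij}\leqslant\varphi_{ik}$.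 A glueing of $\varphi$ is a local homeomorphism $p=\bigvee_i p_i\colon A\to X$, with each $p_i$ a partial isomorphism with partial inverse $s_i$, such that $\varphi_{ij}=p_js_i$. $\mathcal C$ has local glueings if every local atlas on every object has a glueing. The Haefliger groupoid $\Pi(\mathcal C)$ is the partite étale internal groupoid in $\mathcal C$ obtained by internalising the inclusion $\mathrm{PIso}(\mathcal C)\hookrightarrow\mathcal C$ of the category of partial isomorphisms. Explicitly, its source-target spans are as follows: for $A,B\in\mathcal C$ and partial isomorphisms $f,g\colon A\to B$, let $[\![f=g]\!]=\bigvee\{e\in\mathcal O(A): e\leqslant\bar f\bar g,\ fe=ge\}$; then $\sigma_{AB}\colon\Pi(\mathcal C)_{AB}\to A$ is a glueing of the local atlas $([\![f=g]\!])$ on $A$ indexed by the partial isomorphisms $A\to B$, with associated maps $s_f\colon A\to\Pi(\mathcal C)_{AB}$ (the partial inverses of the pieces of $\sigma_{AB}$), and $\tau_{AB}\colon\Pi(\mathcal C)_{AB}\to B$ is the unique total map with $\tau_{AB}s_f=f$ for every partial isomorphism $f\colon A\to B$. *)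

theory Defs
  imports Main "HOL-Library.Equipollence"
begin

record ('o, 'm) cat =
  Ob :: "'o set"
  Mor :: "'m set"
  Dom :: "'m \<Rightarrow> 'o"
  Cod :: "'m \<Rightarrow> 'o"
  Id :: "'o \<Rightarrow> 'm"
  Comp :: "'m \<Rightarrow> 'm \<Rightarrow> 'm" (infixl "\<cdot>\<index>" 70)

definition Hom :: "('o, 'm, 'z) cat_scheme \<Rightarrow> 'o \<Rightarrow> 'o \<Rightarrow> 'm set" where
  "Hom C A B = {f \<in> Mor C. Dom C f = A \<and> Cod C f = B}"

locale category =
  fixes C :: "('o, 'm, 'z) cat_scheme" (structure)
  assumes Dom_Ob: "f \<in> Mor C \<Longrightarrow> Dom C f \<in> Ob C"
    and Cod_Ob: "f \<in> Mor C \<Longrightarrow> Cod C f \<in> Ob C"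
    and Id_Hom: "X \<in> Ob C \<Longrightarrow> Id C X \<in> Hom C X X"
    and Comp_Hom: "\<lbrakk>f \<in> Hom C X Y; g \<in> Hom C Y Z\<rbrakk> \<Longrightarrow> g \<cdot> f \<in> Hom C X Z"
    and Comp_assoc: "\<lbrakk>f \<in> Hom C W X; g \<in> Hom C X Y; h \<in> Hom C Y Z\<rbrakk>
      \<Longrightarrow> (h \<cdot> g) \<cdot> f = h \<cdot> (g \<cdot> f)"
    and Comp_Id: "f \<in> Hom C X Y \<Longrightarrow> f \<cdot> Id C X = f"
    and Id_Comp: "f \<in> Hom C X Y \<Longrightarrow> Id C Y \<cdot> f = f"

definition is_product ::
  "('o, 'm, 'z) cat_scheme \<Rightarrow> 'o \<Rightarrow> 'o \<Rightarrow> 'o \<Rightarrow> 'm \<Rightarrow> 'm \<Rightarrow> bool" where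
  "is_product C A B P p q \<longleftrightarrow>
     A \<in> Ob C \<and> B \<in> Ob C \<and> P \<in> Ob C \<and> p \<in> Hom C P A \<and> q \<in> Hom C P B \<and>
     (\<forall>X \<in> Ob C. \<forall>f \<in> Hom C X A. \<forall>g \<in> Hom C X B.
        \<exists>!h. h \<in> Hom C X P \<and> p \<cdot>\<^bsub>C\<^esub> h = f \<and> q \<cdot>\<^bsub>C\<^esub> h = g)"

record ('o, 'm) restr_cat = "('o, 'm) cat" +
  Rest :: "'m \<Rightarrow> 'm"

locale restriction_category = category C
  for C :: "('o, 'm, 'z) restr_cat_scheme" (structure) +
  assumes Rest_Hom: "f \<in> Hom C X Y \<Longrightarrow> Rest C f \<in> Hom C X X"
    and R1: "f \<in> Hom C X Y \<Longrightarrow> f \<cdot> Rest C f = f"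
    and R2: "\<lbrakk>f \<in> Hom C X Y; g \<in> Hom C X Z\<rbrakk> \<Longrightarrow> Rest C f \<cdot> Rest C g = Rest C g \<cdot> Rest C f"
    and R3: "\<lbrakk>f \<in> Hom C X Y; g \<in> Hom C X Z\<rbrakk> \<Longrightarrow> Rest C (g \<cdot> Rest C f) = Rest C g \<cdot> Rest C f"
    and R4: "\<lbrakk>f \<in> Hom C X Y; g \<in> Hom C Y Z\<rbrakk> \<Longrightarrow> Rest C g \<cdot> f = f \<cdot> Rest C (g \<cdot> f)"

definition restr_idems :: "('o, 'm, 'z) restr_cat_scheme \<Rightarrow> 'o \<Rightarrow> 'm set" where
  "restr_idems C X = {e \<in> Hom C X X. Rest C e = e}"

definition total :: "('o, 'm, 'z) restr_cat_scheme \<Rightarrow> 'm \<Rightarrow> bool" where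
  "total C f \<longleftrightarrow> Rest C f = Id C (Dom C f)"

definition restr_le :: "('o, 'm, 'z) restr_cat_scheme \<Rightarrow> 'm \<Rightarrow> 'm \<Rightarrow> bool"
  (infix "\<sqsubseteq>\<index>" 50) where
  "f \<sqsubseteq>\<^bsub>C\<^esub> g \<longleftrightarrow> f = g \<cdot>\<^bsub>C\<^esub> Rest C f"

definition compatible :: "('o, 'm, 'z) restr_cat_scheme \<Rightarrow> 'm \<Rightarrow> 'm \<Rightarrow> bool" where
  "compatible C f g \<longleftrightarrow> f \<cdot>\<^bsub>C\<^esub> Rest C g = g \<cdot>\<^bsub>C\<^esub> Rest C f"

text \<open>The objects are explicit parameters because the family of maps may be empty.\<close>

definition is_join ::
  "('o, 'm, 'z) restr_cat_scheme \<Rightarrow> 'o \<Rightarrow> 'o \<Rightarrow> 'm set \<Rightarrow> 'm \<Rightarrow> bool" where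
  "is_join C A B F h \<longleftrightarrow>
     F \<subseteq> Hom C A B \<and> h \<in> Hom C A B \<and> (\<forall>f \<in> F. f \<sqsubseteq>\<^bsub>C\<^esub> h) \<and>
     (\<forall>k \<in> Hom C A B. (\<forall>f \<in> F. f \<sqsubseteq>\<^bsub>C\<^esub> k) \<longrightarrow> h \<sqsubseteq>\<^bsub>C\<^esub> k)"

definition join ::
  "('o, 'm, 'z) restr_cat_scheme \<Rightarrow> 'o \<Rightarrow> 'o \<Rightarrow> 'm set \<Rightarrow> 'm" where
  "join C A B F = (THE h. is_join C A B F h)"

locale join_restriction_category = restriction_category C
  for C :: "('o, 'm, 'z) restr_cat_scheme" (structure) +
  assumes join_exists:
      "\<lbrakk>X \<in> Ob C; Y \<in> Ob C; F \<subseteq> Hom C X Y; \<And>f g. \<lbrakk>f \<in> F; g \<in> F\<rbrakk> \<Longrightarrow> compatible C f g\<rbrakk>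
        \<Longrightarrow> \<exists>h. is_join C X Y F h"
    and join_precomp:
      "\<lbrakk>is_join C X Y F h; \<And>f g. \<lbrakk>f \<in> F; g \<in> F\<rbrakk> \<Longrightarrow> compatible C f g; k \<in> Hom C W X\<rbrakk>
        \<Longrightarrow> is_join C W Y ((\<lambda>f. f \<cdot> k) ` F) (h \<cdot> k)"

definition partial_inverse ::
  "('o, 'm, 'z) restr_cat_scheme \<Rightarrow> 'o \<Rightarrow> 'o \<Rightarrow> 'm \<Rightarrow> 'm \<Rightarrow> bool" where
  "partial_inverse C A B s t \<longleftrightarrow>
     s \<in> Hom C A B \<and> t \<in> Hom C B A \<and> t \<cdot>\<^bsub>C\<^esub> s = Rest C s \<and> s \<cdot>\<^bsub>C\<^esub> t = Rest C t"

definition partial_isos :: "('o, 'm, 'z) restr_cat_scheme \<Rightarrow> 'o \<Rightarrow> 'o \<Rightarrow> 'm set" where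
  "partial_isos C A B = {s. \<exists>t. partial_inverse C A B s t}"

definition local_homeos :: "('o, 'm, 'z) restr_cat_scheme \<Rightarrow> 'o \<Rightarrow> 'o \<Rightarrow> 'm set" where
  "local_homeos C A B =
     {f \<in> Hom C A B. total C f \<and> (\<exists>F \<subseteq> partial_isos C A B. is_join C A B F f)}"

definition Lh :: "('o, 'm, 'z) restr_cat_scheme \<Rightarrow> ('o, 'm) cat" where
  "Lh C = \<lparr>Ob = Ob C,
           Mor = {f \<in> Mor C. f \<in> local_homeos C (Dom C f) (Cod C f)},
           Dom = Dom C, Cod = Cod C, Id = Id C, Comp = Comp C\<rparr>"

definition local_atlas ::
  "('o, 'm, 'z) restr_cat_scheme \<Rightarrow> 'o \<Rightarrow> 'i set \<Rightarrow> ('i \<Rightarrow> 'i \<Rightarrow> 'm) \<Rightarrow> bool" where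
  "local_atlas C X I \<phi> \<longleftrightarrow>
     (\<forall>i \<in> I. \<forall>j \<in> I. \<phi> i j \<in> restr_idems C X) \<and>
     (\<forall>i \<in> I. \<forall>j \<in> I. \<phi> i j = \<phi> j i) \<and>
     (\<forall>i \<in> I. \<forall>j \<in> I. \<forall>k \<in> I. \<phi> j k \<cdot>\<^bsub>C\<^esub> \<phi> i j \<sqsubseteq>\<^bsub>C\<^esub> \<phi> i k)"

text \<open>
  A glueing \<open>p : P \<rightarrow> X\<close> of \<open>\<phi>\<close>, together with its pieces \<open>q i : P \<rightarrow> X\<close> and
  their partial inverses \<open>s i : X \<rightarrow> P\<close>.
\<close>

definition glueing ::
  "('o, 'm, 'z) restr_cat_scheme \<Rightarrow> 'o \<Rightarrow> 'i set \<Rightarrow> ('i \<Rightarrow> 'i \<Rightarrow> 'm)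
    \<Rightarrow> 'o \<Rightarrow> 'm \<Rightarrow> ('i \<Rightarrow> 'm) \<Rightarrow> ('i \<Rightarrow> 'm) \<Rightarrow> bool" where
  "glueing C X I \<phi> P p q s \<longleftrightarrow>
     P \<in> Ob C \<and> p \<in> local_homeos C P X \<and>
     (\<forall>i \<in> I. partial_inverse C P X (q i) (s i)) \<and>
     is_join C P X (q ` I) p \<and>
     (\<forall>i \<in> I. \<forall>j \<in> I. \<phi> i j = q j \<cdot>\<^bsub>C\<^esub> s i)"

text \<open>
  The hom-sets of \<open>C\<close> and the index sets of local atlases are sets, whereas the
  collection of all maps of \<open>C\<close> may be a proper class.  Since \<open>'m\<close> is the type of
  all maps, this distinction has to be made by a predicate \<open>small\<close> on sets over
  \<open>'m\<close>.  It cannot be dropped: a glueing of the discrete atlas (\<open>\<phi> i i = 1\<close>, and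
  \<open>\<phi> i j = 0\<close> for \<open>i \<noteq> j\<close>) with index set \<open>I\<close> on an object with \<open>0 \<noteq> 1\<close> has at
  least \<open>2\<close> to the power \<open>|I|\<close> maps into that object, so glueings for all index
  sets \<open>I :: 'm set\<close> exist only when \<open>C\<close> is trivial.  Closure under \<open>\<lesssim>\<close> is the
  only property of small sets that is required; hence \<open>small\<close> can be
  instantiated with genuine smallness, with finiteness, or with any other
  cardinality bound.
\<close>

definition smallness :: "('a set \<Rightarrow> bool) \<Rightarrow> bool" where
  "smallness small \<longleftrightarrow> (\<forall>X Y. small Y \<and> X \<lesssim> Y \<longrightarrow> small X)"

definition locally_small :: "('m set \<Rightarrow> bool) \<Rightarrow> ('o, 'm, 'z) cat_scheme \<Rightarrow> bool" where
  "locally_small small C \<longleftrightarrow> (\<forall>A \<in> Ob C. \<forall>B \<in> Ob C. small (Hom C A B))"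

definition has_local_glueings ::
  "('m set \<Rightarrow> bool) \<Rightarrow> ('o, 'm, 'z) restr_cat_scheme \<Rightarrow> bool" where
  "has_local_glueings small C \<longleftrightarrow>
     (\<forall>X \<in> Ob C. \<forall>I \<phi>. small I \<and> local_atlas C X I \<phi> \<longrightarrow> (\<exists>P p q s. glueing C X I \<phi> P p q s))"

definition equalizing_idem ::
  "('o, 'm, 'z) restr_cat_scheme \<Rightarrow> 'o \<Rightarrow> 'm \<Rightarrow> 'm \<Rightarrow> 'm" where
  "equalizing_idem C A f g =
     join C A A {e \<in> restr_idems C A. e \<sqsubseteq>\<^bsub>C\<^esub> Rest C f \<cdot>\<^bsub>C\<^esub> Rest C g \<and> f \<cdot>\<^bsub>C\<^esub> e = g \<cdot>\<^bsub>C\<^esub> e}"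

text \<open>
  The component at \<open>(A, B)\<close> of the Haefliger groupoid: \<open>P\<close> is its object of
  arrows from \<open>A\<close> to \<open>B\<close>, \<open>\<sigma> : P \<rightarrow> A\<close> its source map with pieces \<open>q f\<close>, and
  \<open>s f : A \<rightarrow> P\<close> the map associated with the partial isomorphism \<open>f : A \<rightarrow> B\<close>.
  Glueings are only determined up to isomorphism, so this is a predicate; the
  target map is then determined by the maps \<open>s f\<close>.
\<close>

definition haefliger_source ::
  "('o, 'm, 'z) restr_cat_scheme \<Rightarrow> 'o \<Rightarrow> 'o \<Rightarrow> 'o \<Rightarrow> 'm \<Rightarrow> ('m \<Rightarrow> 'm) \<Rightarrow> ('m \<Rightarrow> 'm) \<Rightarrow> bool" where
  "haefliger_source C A B P \<sigma> q s \<longleftrightarrow>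
     glueing C A (partial_isos C A B) (equalizing_idem C A) P \<sigma> q s"

definition haefliger_target ::
  "('o, 'm, 'z) restr_cat_scheme \<Rightarrow> 'o \<Rightarrow> 'o \<Rightarrow> 'o \<Rightarrow> ('m \<Rightarrow> 'm) \<Rightarrow> 'm" where
  "haefliger_target C A B P s =
     (THE t. t \<in> Hom C P B \<and> total C t \<and> (\<forall>f \<in> partial_isos C A B. t \<cdot>\<^bsub>C\<^esub> s f = f))"

end

theory Submission
  imports Defs
begin

text \<open>
  Write \<open>s f\<close> for the section of \<open>\<sigma>\<close> belonging to a partial isomorphism \<open>f : A \<rightarrow> B\<close>, so
  that \<open>\<sigma> (s f)\<close> is the domain of \<open>f\<close>, and \<open>\<tau> (s f) = f\<close>.  A pair of local homeomorphisms
  \<open>a : X \<rightarrow> A\<close>, \<open>b : X \<rightarrow> B\<close> is locally a pair of partial isomorphisms \<open>\<alpha>\<close>, \<open>\<beta>\<close> with a common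
  domain, and there \<open>s (\<beta> \<alpha>\<^sup>*) \<alpha>\<close> lies over \<open>(\<alpha>, \<beta>)\<close>.  Conversely, two maps \<open>h\<close>, \<open>k\<close> into
  the glueing with \<open>\<sigma> h = \<sigma> k\<close> a partial isomorphism \<open>w\<close> and \<open>\<tau> h = \<tau> k\<close> are locally \<open>s f w\<close>
  and \<open>s g w\<close> with \<open>f w = g w\<close>; cancelling \<open>w\<close> shows that its image lies in the region where
  \<open>f\<close> and \<open>g\<close> agree, on which \<open>s f\<close> and \<open>s g\<close> coincide by the glueing condition.  This
  joint monicity makes the local solutions compatible and their join unique.
\<close>

section \<open>Restriction categories\<close>

context category
begin

lemma Comp_simps [simp]:
  assumes "f \<in> Mor C" "g \<in> Mor C" "Dom C g = Cod C f"
  shows "g \<cdot> f \<in> Mor C" "Dom C (g \<cdot> f) = Dom C f" "Cod C (g \<cdot> f) = Cod C g"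
  using Comp_Hom[of f "Dom C f" "Cod C f" g "Cod C g"] assms by (auto simp: Hom_def)

lemma Comp_assoc_Mor [simp]:
  assumes "f \<in> Mor C" "g \<in> Mor C" "h \<in> Mor C" "Dom C g = Cod C f" "Dom C h = Cod C g"
  shows "(h \<cdot> g) \<cdot> f = h \<cdot> (g \<cdot> f)"
  using Comp_assoc[of f "Dom C f" "Cod C f" g "Cod C g" h "Cod C h"] assms by (auto simp: Hom_def)

text \<open>The simplifier nests composites to the right, where a known equation
  \<open>h \<cdot> g = k\<close> no longer matches; this rule applies it there.\<close>

lemma Comp_reassoc:
  assumes "h \<cdot> g = k" "f \<in> Mor C" "g \<in> Mor C" "h \<in> Mor C" "Dom C g = Cod C f" "Dom C h = Cod C g"
  shows "h \<cdot> (g \<cdot> f) = k \<cdot> f"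
  using Comp_assoc_Mor[OF assms(2-)] assms(1) by metis

lemma Id_simps [simp]:
  assumes "X \<in> Ob C"
  shows "Id C X \<in> Mor C" "Dom C (Id C X) = X" "Cod C (Id C X) = X"
  using Id_Hom[OF assms] by (auto simp: Hom_def)

lemma Comp_Id_Mor [simp]: "\<lbrakk>f \<in> Mor C; X = Dom C f\<rbrakk> \<Longrightarrow> f \<cdot> Id C X = f"
  using Comp_Id[of f "Dom C f" "Cod C f"] by (auto simp: Hom_def)

lemma Id_Comp_Mor [simp]: "\<lbrakk>f \<in> Mor C; X = Cod C f\<rbrakk> \<Longrightarrow> Id C X \<cdot> f = f"
  using Id_Comp[of f "Dom C f" "Cod C f"] by (auto simp: Hom_def)

end

context restriction_category
begin

lemma Rest_simps [simp]:
  assumes "f \<in> Mor C"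
  shows "Rest C f \<in> Mor C" "Dom C (Rest C f) = Dom C f" "Cod C (Rest C f) = Dom C f"
  using Rest_Hom[of f "Dom C f" "Cod C f"] assms by (auto simp: Hom_def)

lemma Comp_Rest [simp]: "f \<in> Mor C \<Longrightarrow> f \<cdot> Rest C f = f"
  using R1[of f "Dom C f" "Cod C f"] by (auto simp: Hom_def)

lemma Comp_Rest_left [simp]:
  "\<lbrakk>f \<in> Mor C; x \<in> Mor C; Cod C x = Dom C f\<rbrakk> \<Longrightarrow> f \<cdot> (Rest C f \<cdot> x) = f \<cdot> x"
  by (rule Comp_reassoc) simp_all

lemma Rest_commute:
  "\<lbrakk>f \<in> Mor C; g \<in> Mor C; Dom C f = Dom C g\<rbrakk> \<Longrightarrow> Rest C f \<cdot> Rest C g = Rest C g \<cdot> Rest C f"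
  using R2[of f "Dom C f" "Cod C f" g "Cod C g"] by (auto simp: Hom_def)

lemma Rest_left_commute:
  "\<lbrakk>f \<in> Mor C; g \<in> Mor C; x \<in> Mor C; Dom C f = Dom C g; Cod C x = Dom C g\<rbrakk>
    \<Longrightarrow> Rest C f \<cdot> (Rest C g \<cdot> x) = Rest C g \<cdot> (Rest C f \<cdot> x)"
  by (rule Comp_reassoc[OF Rest_commute, THEN trans]) simp_all

lemma Rest_Comp_Rest [simp]:
  "\<lbrakk>f \<in> Mor C; g \<in> Mor C; Dom C f = Dom C g\<rbrakk> \<Longrightarrow> Rest C (g \<cdot> Rest C f) = Rest C g \<cdot> Rest C f"
  using R3[of f "Dom C f" "Cod C f" g "Cod C g"] by (auto simp: Hom_def)

lemma Rest_Comp_eq: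
  "\<lbrakk>f \<in> Mor C; g \<in> Mor C; Dom C g = Cod C f\<rbrakk> \<Longrightarrow> Rest C g \<cdot> f = f \<cdot> Rest C (g \<cdot> f)"
  using R4[of f "Dom C f" "Cod C f" g "Cod C g"] by (auto simp: Hom_def)

lemma Rest_Id [simp]: "X \<in> Ob C \<Longrightarrow> Rest C (Id C X) = Id C X"
  using Comp_Rest[of "Id C X"] Id_Comp_Mor[of "Rest C (Id C X)" X] by simp

lemma Rest_Rest [simp]: "f \<in> Mor C \<Longrightarrow> Rest C (Rest C f) = Rest C f"
  using Rest_Comp_Rest[of f "Id C (Dom C f)"] Dom_Ob[of f] by simp

lemma Rest_Comp_self [simp]: "f \<in> Mor C \<Longrightarrow> Rest C f \<cdot> Rest C f = Rest C f"
  using Comp_Rest[of "Rest C f"] by simp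

lemma Rest_Comp_self_left [simp]:
  "\<lbrakk>f \<in> Mor C; x \<in> Mor C; Cod C x = Dom C f\<rbrakk> \<Longrightarrow> Rest C f \<cdot> (Rest C f \<cdot> x) = Rest C f \<cdot> x"
  using Comp_Rest_left[of "Rest C f"] by simp

lemma Rest_Comp_Rest_right [simp]:
  assumes "f \<in> Mor C" "g \<in> Mor C" "Dom C g = Cod C f"
  shows "Rest C (g \<cdot> f) \<cdot> Rest C f = Rest C (g \<cdot> f)"
  using Rest_Comp_Rest[of f "g \<cdot> f"] assms by simp

lemma Rest_Rest_Comp [simp]:
  assumes "f \<in> Mor C" "g \<in> Mor C" "Dom C g = Cod C f"
  shows "Rest C (Rest C g \<cdot> f) = Rest C (g \<cdot> f)"
  using Rest_Comp_eq[OF assms] Rest_commute[of f "g \<cdot> f"] assms by simp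

lemma Rest_Comp_total:
  assumes "f \<in> Mor C" "g \<in> Mor C" "Dom C g = Cod C f" "total C g"
  shows "Rest C (g \<cdot> f) = Rest C f"
  using assms by (simp add: total_def flip: Rest_Rest_Comp[OF assms(1-3)])

lemma restr_le_antisym:
  assumes "f \<in> Hom C X Y" "g \<in> Hom C X Y" "f \<sqsubseteq> g" "g \<sqsubseteq> f"
  shows "f = g"
proof -
  have f: "f = g \<cdot> Rest C f" and g: "g = f \<cdot> Rest C g"
    using assms by (auto simp: restr_le_def)
  have "Rest C f = Rest C g \<cdot> Rest C f" "Rest C g = Rest C f \<cdot> Rest C g"
    using arg_cong[OF f, of "Rest C"] arg_cong[OF g, of "Rest C"] assms by (auto simp: Hom_def)
  then have "Rest C f = Rest C g"
    using Rest_commute[of f g] assms by (simp add: Hom_def)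
  then show ?thesis
    using f assms by (simp add: Hom_def)
qed

lemma restr_idems_Rest: "f \<in> Hom C X Y \<Longrightarrow> Rest C f \<in> restr_idems C X"
  by (simp add: restr_idems_def Hom_def)

lemma restr_idems_Hom: "e \<in> restr_idems C X \<Longrightarrow> e \<in> Hom C X X"
  by (simp add: restr_idems_def)

lemma restr_idems_Comp:
  assumes "d \<in> restr_idems C X" "e \<in> restr_idems C X"
  shows "d \<cdot> e \<in> restr_idems C X"
  using assms Rest_Comp_Rest[of e d] by (simp add: restr_idems_def Hom_def)

lemma restr_idems_commute:
  assumes "d \<in> restr_idems C X" "e \<in> restr_idems C X"
  shows "d \<cdot> e = e \<cdot> d"
  using assms Rest_commute[of e d] by (simp add: restr_idems_def Hom_def)

lemma restr_idems_idem:
  assumes "e \<in> restr_idems C X"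
  shows "e \<cdot> e = e"
  using assms Comp_Rest[of e] by (simp add: restr_idems_def Hom_def)

lemma restr_le_restr_idems:
  assumes "d \<in> restr_idems C X" "e \<in> Hom C X X" "e \<sqsubseteq> d"
  shows "e \<in> restr_idems C X"
proof -
  have e: "d \<cdot> Rest C e = e" using assms(3) by (simp add: restr_le_def)
  have "Rest C (d \<cdot> Rest C e) = d \<cdot> Rest C e"
    using assms(1,2) by (simp add: restr_idems_def Hom_def)
  then show ?thesis using e assms(2) by (simp add: restr_idems_def)
qed

lemma is_join_unique: "\<lbrakk>is_join C X Y F h; is_join C X Y F k\<rbrakk> \<Longrightarrow> h = k"
  by (rule restr_le_antisym[of _ X Y]) (auto simp: is_join_def)

lemma join_eq: "is_join C X Y F h \<Longrightarrow> join C X Y F = h"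
  unfolding join_def by (rule the_equality) (auto intro: is_join_unique)

lemma is_join_piece: "\<lbrakk>is_join C X Y F h; f \<in> F\<rbrakk> \<Longrightarrow> h \<cdot> Rest C f = f"
  by (auto simp: is_join_def restr_le_def)

text \<open>Each member is \<open>h\<close> cut down to its own domain, and restriction idempotents
  commute. This supplies the compatibility that \<open>join_exists\<close> requires whenever an
  upper bound is known.\<close>

lemma bounded_compatible:
  assumes "F \<subseteq> Hom C X Y" "h \<in> Hom C X Y" "\<And>f. f \<in> F \<Longrightarrow> f \<sqsubseteq> h" "f \<in> F" "g \<in> F"
  shows "compatible C f g"
proof -
  have m: "f \<in> Hom C X Y" "g \<in> Hom C X Y"
    using assms by auto
  have "h \<cdot> Rest C f = f" "h \<cdot> Rest C g = g"
    using assms by (auto simp: restr_le_def)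
  then have "h \<cdot> (Rest C f \<cdot> Rest C g) = f \<cdot> Rest C g" "h \<cdot> (Rest C g \<cdot> Rest C f) = g \<cdot> Rest C f"
    using assms(2) m by (auto intro!: Comp_reassoc simp: Hom_def)
  moreover have "Rest C f \<cdot> Rest C g = Rest C g \<cdot> Rest C f"
    using m Rest_commute[of f g] by (simp add: Hom_def)
  ultimately show ?thesis
    by (simp add: compatible_def)
qed

lemma is_join_compatible: "\<lbrakk>is_join C X Y F h; f \<in> F; g \<in> F\<rbrakk> \<Longrightarrow> compatible C f g"
  by (rule bounded_compatible[of F X Y h]) (auto simp: is_join_def)

end

section \<open>Joins\<close>

context join_restriction_category
begin

lemma is_join_Comp_right:
  "\<lbrakk>is_join C X Y F h; k \<in> Hom C W X\<rbrakk> \<Longrightarrow> is_join C W Y ((\<lambda>f. f \<cdot> k) ` F) (h \<cdot> k)"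
  using join_precomp is_join_compatible by blast

lemma Hom_Ob: "f \<in> Hom C X Y \<Longrightarrow> X \<in> Ob C \<and> Y \<in> Ob C"
  using Dom_Ob Cod_Ob by (auto simp: Hom_def)

text \<open>The restrictions are bounded by \<open>Rest C h\<close>, so they have a join
  \<open>e\<close> below it. Cutting \<open>h\<close> down to \<open>e\<close> loses no member of
  \<open>F\<close>, so leastness of \<open>h\<close> forces \<open>e\<close> to be the whole domain
  of \<open>h\<close>.\<close>

lemma is_join_Rest:
  assumes "is_join C X Y F h"
  shows "is_join C X X (Rest C ` F) (Rest C h)"
proof -
  have F: "F \<subseteq> Hom C X Y" and h: "h \<in> Hom C X Y"
    using assms by (auto simp: is_join_def)
  note p = is_join_piece[OF assms]
  have R: "Rest C ` F \<subseteq> Hom C X X"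
    using F by (auto simp: Hom_def)
  have le: "r \<sqsubseteq> Rest C h" if r: "r \<in> Rest C ` F" for r
  proof -
    obtain f where f: "f \<in> F" "r = Rest C f" using r by auto
    have "Rest C (h \<cdot> Rest C f) = Rest C f" using p[OF f(1)] by simp
    then show ?thesis using f F h by (auto simp: restr_le_def Hom_def)
  qed
  have hR: "Rest C h \<in> Hom C X X" using h by (simp add: Hom_def)
  obtain e where e: "is_join C X X (Rest C ` F) e"
    using join_exists[OF _ _ R bounded_compatible[OF R hR le]] Hom_Ob[OF h] by blast
  have eH: "e \<in> Hom C X X" using e by (simp add: is_join_def)
  have eh: "e \<sqsubseteq> Rest C h"
    using e hR le by (auto simp: is_join_def)
  then have eR: "Rest C e = e"
    using restr_le_restr_idems[OF restr_idems_Rest[OF h] eH] by (simp add: restr_idems_def)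
  have "f \<sqsubseteq> h \<cdot> e" if f: "f \<in> F" for f
  proof -
    have "e \<cdot> Rest C f = Rest C f"
      using is_join_piece[OF e, of "Rest C f"] f F by (auto simp: Hom_def)
    then show ?thesis
      using p[OF f] f F h eH by (auto simp: restr_le_def Hom_def)
  qed
  moreover have "h \<cdot> e \<in> Hom C X Y" using h eH by (simp add: Hom_def)
  \<comment> \<open>\<open>h \<cdot> e\<close> is an upper bound of \<open>F\<close>. The
    calculation below turns this into \<open>h \<cdot> Rest C e = h\<close>, and taking restrictions
    gives \<open>Rest C h = e\<close>.\<close>
  ultimately have "h \<sqsubseteq> h \<cdot> e"
    using assms by (auto simp: is_join_def)
  then have "h = (h \<cdot> e) \<cdot> Rest C h" by (simp add: restr_le_def)
  also have "\<dots> = h \<cdot> (Rest C e \<cdot> Rest C h)" using h eH eR by (simp add: Hom_def)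
  also have "\<dots> = h \<cdot> (Rest C h \<cdot> Rest C e)"
    using Rest_commute[of e h] h eH by (simp add: Hom_def)
  also have "\<dots> = h \<cdot> Rest C e" using h eH by (simp add: Hom_def)
  finally have "h \<cdot> Rest C e = h" by (rule sym)
  moreover have "Rest C (h \<cdot> Rest C e) = Rest C h \<cdot> Rest C e" using h eH by (simp add: Hom_def)
  moreover have "Rest C h \<cdot> Rest C e = e"
    using eh by (simp add: restr_le_def)
  ultimately have "Rest C h = e" by simp
  then show ?thesis using e by simp
qed

text \<open>Only precomposition preserves joins by axiom. Here the join \<open>m\<close> of the
  composites lies below \<open>k \<cdot> h\<close>, and comparable maps with equal restrictions
  coincide, so it suffices to compare domains; \<open>is_join_Rest\<close> reduces that to
  precomposition.\<close>

lemma is_join_Comp_left: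
  assumes "is_join C X Y F h" and k: "k \<in> Hom C Y Z"
  shows "is_join C X Z ((\<lambda>f. k \<cdot> f) ` F) (k \<cdot> h)"
proof -
  have F: "F \<subseteq> Hom C X Y" and h: "h \<in> Hom C X Y"
    using assms by (auto simp: is_join_def)
  note p = is_join_piece[OF assms(1)]
  let ?G = "(\<lambda>f. k \<cdot> f) ` F"
  have G: "?G \<subseteq> Hom C X Z" using F k by (auto simp: Hom_def)
  have kh: "k \<cdot> h \<in> Hom C X Z" using h k by (auto simp: Hom_def)
  \<comment> \<open>The domain of \<open>k \<cdot> f\<close> is that of \<open>f\<close> cut down to
    the domain of \<open>k \<cdot> h\<close>: this rewrites a postcomposition by \<open>k\<close> as
    a precomposition by a restriction idempotent.\<close>
  have R: "Rest C (f \<cdot> Rest C (k \<cdot> h)) = Rest C (k \<cdot> f)" if f: "f \<in> F" for f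
  proof -
    have fH: "f \<in> Hom C X Y" using f F by auto
    have "Rest C (k \<cdot> (h \<cdot> Rest C f)) = Rest C (k \<cdot> h) \<cdot> Rest C f"
      using fH h k Rest_Comp_Rest[of f "k \<cdot> h"] by (simp add: Hom_def)
    then show ?thesis
      using p[OF f] fH h k Rest_commute[of f "k \<cdot> h"] by (simp add: Hom_def)
  qed
  have le: "g \<sqsubseteq> k \<cdot> h" if g: "g \<in> ?G" for g
  proof -
    obtain f where f: "f \<in> F" "g = k \<cdot> f" using g by auto
    have fH: "f \<in> Hom C X Y" using f F by auto
    have "k \<cdot> f = k \<cdot> (h \<cdot> Rest C f)" using p[OF f(1)] by simp
    then have "(k \<cdot> h) \<cdot> Rest C (k \<cdot> f) = (k \<cdot> h) \<cdot> (Rest C f \<cdot> Rest C (k \<cdot> h))"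
      using R[OF f(1)] fH h k by (simp add: Hom_def)
    also have "\<dots> = (k \<cdot> h) \<cdot> (Rest C (k \<cdot> h) \<cdot> Rest C f)"
      using Rest_commute[of f "k \<cdot> h"] fH h k by (simp add: Hom_def)
    also have "\<dots> = (k \<cdot> h) \<cdot> Rest C f"
      using Comp_Rest_left[of "k \<cdot> h" "Rest C f"] fH h k by (simp add: Hom_def)
    also have "\<dots> = k \<cdot> f" using p[OF f(1)] fH h k by (simp add: Hom_def)
    finally show ?thesis using f by (simp add: restr_le_def)
  qed
  obtain m where m: "is_join C X Z ?G m"
    using join_exists[OF _ _ G bounded_compatible[OF G kh le]] Hom_Ob[OF kh] by blast
  have mH: "m \<in> Hom C X Z" using m by (simp add: is_join_def)
  have "m \<sqsubseteq> k \<cdot> h" using m kh le by (auto simp: is_join_def)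
  then have m_eq: "m = (k \<cdot> h) \<cdot> Rest C m" by (simp add: restr_le_def)
  have rkh: "Rest C (k \<cdot> h) \<in> Hom C X X" using kh by (simp add: Hom_def)
  have "is_join C X X (Rest C ` (\<lambda>f. f \<cdot> Rest C (k \<cdot> h)) ` F) (Rest C (h \<cdot> Rest C (k \<cdot> h)))"
    by (rule is_join_Rest is_join_Comp_right assms rkh)+
  moreover have "Rest C ` (\<lambda>f. f \<cdot> Rest C (k \<cdot> h)) ` F = Rest C ` ?G"
    using R by (force simp: image_image)
  moreover have "Rest C (h \<cdot> Rest C (k \<cdot> h)) = Rest C (k \<cdot> h)"
    using h k Rest_commute[of h "k \<cdot> h"] by (simp add: Hom_def)
  ultimately have "is_join C X X (Rest C ` ?G) (Rest C (k \<cdot> h))" by simp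
  then have "Rest C m = Rest C (k \<cdot> h)"
    using is_join_Rest[OF m] is_join_unique by blast
  then have "m = k \<cdot> h"
    using m_eq kh by (simp add: Hom_def del: Comp_assoc_Mor)
  then show ?thesis using m by simp
qed

text \<open>Since postcomposition preserves joins, both sides are the join of one and the same
  family. This is the locality principle behind all later gluing arguments.\<close>

lemma eq_on_join:
  assumes J: "is_join C X Y F h" and f: "f \<in> Hom C X Z" and g: "g \<in> Hom C X Z"
    and eq: "\<And>k. k \<in> F \<Longrightarrow> f \<cdot> Rest C k = g \<cdot> Rest C k"
  shows "f \<cdot> Rest C h = g \<cdot> Rest C h"
proof -
  have "(\<lambda>r. f \<cdot> r) ` Rest C ` F = (\<lambda>r. g \<cdot> r) ` Rest C ` F"
    using eq by (auto simp: image_image)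
  then show ?thesis
    using is_join_Comp_left[OF is_join_Rest[OF J] f] is_join_Comp_left[OF is_join_Rest[OF J] g]
      is_join_unique by metis
qed

lemma eq_on_total_join:
  assumes "is_join C X Y F h" "total C h" "f \<in> Hom C X Z" "g \<in> Hom C X Z"
    and "\<And>k. k \<in> F \<Longrightarrow> f \<cdot> Rest C k = g \<cdot> Rest C k"
  shows "f = g"
proof -
  have "Rest C h = Id C X" using assms(1,2) by (auto simp: total_def is_join_def Hom_def)
  then show ?thesis
    using eq_on_join[OF assms(1,3-)] assms(3,4) by (auto simp: Hom_def)
qed

end

section \<open>Partial isomorphisms\<close>

context restriction_category
begin

lemma partial_inverse_sym: "partial_inverse C X Y s t \<Longrightarrow> partial_inverse C Y X t s"
  by (simp add: partial_inverse_def)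

text \<open>Axiom \<open>R4\<close> moves \<open>Rest C g\<close> to the other side of
  \<open>f\<close>. This is one of the two laws for the composite; the other is the same law with
  the roles of maps and inverses exchanged.\<close>

lemma partial_inverse_Comp_Rest:
  assumes "partial_inverse C X Y f f'" "partial_inverse C Y Z g g'"
  shows "(f' \<cdot> g') \<cdot> (g \<cdot> f) = Rest C (g \<cdot> f)"
proof -
  have h: "f \<in> Hom C X Y" "f' \<in> Hom C Y X" "g \<in> Hom C Y Z" "g' \<in> Hom C Z Y"
    and e: "f' \<cdot> f = Rest C f" "g' \<cdot> g = Rest C g"
    using assms by (auto simp: partial_inverse_def)
  have "(f' \<cdot> g') \<cdot> (g \<cdot> f) = f' \<cdot> ((g' \<cdot> g) \<cdot> f)" using h by (simp add: Hom_def)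
  also have "\<dots> = f' \<cdot> (f \<cdot> Rest C (g \<cdot> f))" using h e Rest_Comp_eq[of f g] by (simp add: Hom_def)
  also have "\<dots> = (f' \<cdot> f) \<cdot> Rest C (g \<cdot> f)" using h by (simp add: Hom_def)
  also have "\<dots> = Rest C (g \<cdot> f)"
    using h e Rest_commute[of f "g \<cdot> f"] by (simp add: Hom_def)
  finally show ?thesis .
qed

lemma partial_inverse_Comp:
  assumes "partial_inverse C X Y f f'" "partial_inverse C Y Z g g'"
  shows "partial_inverse C X Z (g \<cdot> f) (f' \<cdot> g')"
  using partial_inverse_Comp_Rest[OF assms] assms
    partial_inverse_Comp_Rest[OF partial_inverse_sym[OF assms(2)] partial_inverse_sym[OF assms(1)]]
  by (auto simp: partial_inverse_def intro: Comp_Hom)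

lemma partial_isos_Hom: "f \<in> partial_isos C X Y \<Longrightarrow> f \<in> Hom C X Y"
  by (auto simp: partial_isos_def partial_inverse_def)

lemma partial_isos_Comp:
  "\<lbrakk>f \<in> partial_isos C X Y; g \<in> partial_isos C Y Z\<rbrakk> \<Longrightarrow> g \<cdot> f \<in> partial_isos C X Z"
  unfolding partial_isos_def using partial_inverse_Comp by blast

lemma restr_idems_partial_isos: "e \<in> restr_idems C X \<Longrightarrow> e \<in> partial_isos C X X"
  unfolding partial_isos_def partial_inverse_def
  using restr_idems_idem[of e X] by (auto simp: restr_idems_def)

lemma partial_isos_Comp_Rest:
  "\<lbrakk>f \<in> partial_isos C X Y; g \<in> Hom C X Z\<rbrakk> \<Longrightarrow> f \<cdot> Rest C g \<in> partial_isos C X Y"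
  by (rule partial_isos_Comp[OF restr_idems_partial_isos[OF restr_idems_Rest]])

lemma partial_inverse_absorb:
  assumes "partial_inverse C X Y s t"
  shows "s \<cdot> (t \<cdot> s) = s" "Rest C t \<cdot> s = s"
proof -
  show "s \<cdot> (t \<cdot> s) = s" using assms by (simp add: partial_inverse_def Hom_def)
  then show "Rest C t \<cdot> s = s" using assms
    by (metis (no_types, lifting) Comp_assoc partial_inverse_def)
qed

end

section \<open>The local atlas of equalizing idempotents\<close>

context join_restriction_category
begin

text \<open>The idempotents in the defining family are bounded by
  \<open>Rest C f \<cdot> Rest C g\<close>, hence compatible, so the definite description denotes an
  actual join; agreement on each member passes to the join by \<open>eq_on_join\<close>.\<close>

lemma equalizing_idem_props:
  assumes f: "f \<in> Hom C A B" and g: "g \<in> Hom C A B"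
  defines "E \<equiv> equalizing_idem C A f g"
  shows "E \<in> restr_idems C A" "E \<sqsubseteq> Rest C f \<cdot> Rest C g" "f \<cdot> E = g \<cdot> E"
    and "\<And>e. \<lbrakk>e \<in> restr_idems C A; e \<sqsubseteq> Rest C f \<cdot> Rest C g; f \<cdot> e = g \<cdot> e\<rbrakk> \<Longrightarrow> E \<cdot> e = e"
proof -
  define S where "S = {e \<in> restr_idems C A. e \<sqsubseteq> Rest C f \<cdot> Rest C g \<and> f \<cdot> e = g \<cdot> e}"
  let ?r = "Rest C f \<cdot> Rest C g"
  have S: "S \<subseteq> Hom C A A" by (auto simp: S_def restr_idems_def)
  have r: "?r \<in> Hom C A A" using f g by (simp add: Hom_def)
  have rR: "Rest C ?r = ?r" using f g by (simp add: Hom_def)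
  have le: "\<And>e. e \<in> S \<Longrightarrow> e \<sqsubseteq> ?r" by (simp add: S_def)
  obtain J where J: "is_join C A A S J"
    using join_exists[OF _ _ S bounded_compatible[OF S r le]] Hom_Ob[OF f] by blast
  have E: "E = J" unfolding E_def equalizing_idem_def using join_eq[OF J] by (simp add: S_def)
  have JH: "J \<in> Hom C A A" using J by (simp add: is_join_def)
  show le': "E \<sqsubseteq> ?r" using J r le by (simp add: is_join_def E)
  have "?r \<in> restr_idems C A" using r rR by (simp add: restr_idems_def)
  then show 1: "E \<in> restr_idems C A" using restr_le_restr_idems JH le' by (simp add: E)
  then have RJ: "Rest C J = J" by (simp add: E restr_idems_def)
  show "f \<cdot> E = g \<cdot> E"
    using eq_on_join[OF J f g] RJ by (auto simp: E S_def restr_idems_def)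
  show "E \<cdot> e = e" if "e \<in> restr_idems C A" "e \<sqsubseteq> ?r" "f \<cdot> e = g \<cdot> e" for e
    using is_join_piece[OF J, of e] that by (simp add: E S_def restr_idems_def)
qed

lemma equalizing_idem_commute:
  assumes "f \<in> Hom C A B" "g \<in> Hom C A B"
  shows "equalizing_idem C A f g = equalizing_idem C A g f"
proof -
  have "Rest C f \<cdot> Rest C g = Rest C g \<cdot> Rest C f"
    using assms by (auto intro: Rest_commute simp: Hom_def)
  then show ?thesis unfolding equalizing_idem_def by metis
qed

lemma equalizing_idem_absorb:
  assumes f: "f \<in> Hom C A B" and g: "g \<in> Hom C A B"
  defines "E \<equiv> equalizing_idem C A f g"
  shows "Rest C f \<cdot> E = E" "Rest C g \<cdot> E = E"
proof -
  have E: "E \<in> Hom C A A" and e: "(Rest C f \<cdot> Rest C g) \<cdot> E = E"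
    using equalizing_idem_props[OF f g] by (auto simp: E_def restr_le_def restr_idems_def)
  have 1: "Rest C f \<cdot> (Rest C g \<cdot> E) = E"
    using e f g E by (simp add: Hom_def)
  then have 2: "Rest C g \<cdot> (Rest C f \<cdot> E) = E"
    using f g E Rest_left_commute[of f g E] by (simp add: Hom_def)
  have "Rest C f \<cdot> (Rest C f \<cdot> (Rest C g \<cdot> E)) = Rest C f \<cdot> (Rest C g \<cdot> E)"
    "Rest C g \<cdot> (Rest C g \<cdot> (Rest C f \<cdot> E)) = Rest C g \<cdot> (Rest C f \<cdot> E)"
    using f g E by (simp_all add: Hom_def)
  then show "Rest C f \<cdot> E = E" "Rest C g \<cdot> E = E"
    by (metis 1 2)+
qed

text \<open>Restates maximality with the order conditions replaced by absorption equations, the form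
  in which they arise later.\<close>

lemma equalizing_idem_greatest:
  assumes f: "f \<in> Hom C A B" and g: "g \<in> Hom C A B" and e: "e \<in> restr_idems C A"
    and "Rest C f \<cdot> e = e" "Rest C g \<cdot> e = e" "f \<cdot> e = g \<cdot> e"
  shows "equalizing_idem C A f g \<cdot> e = e"
proof (rule equalizing_idem_props(4)[OF f g e _ assms(6)])
  have "(Rest C f \<cdot> Rest C g) \<cdot> e = Rest C f \<cdot> (Rest C g \<cdot> e)"
    using f g restr_idems_Hom[OF e] by (simp add: Hom_def)
  then show "e \<sqsubseteq> Rest C f \<cdot> Rest C g"
    using assms(4,5) e by (simp add: restr_le_def restr_idems_def)
qed

lemma equalizing_idem_self:
  assumes f: "f \<in> Hom C A B"
  shows "equalizing_idem C A f f = Rest C f"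
proof -
  have "equalizing_idem C A f f \<cdot> Rest C f = Rest C f"
    by (rule equalizing_idem_greatest[OF f f restr_idems_Rest[OF f]]) (use f in \<open>simp_all add: Hom_def\<close>)
  then show ?thesis
    using equalizing_idem_absorb(1)[OF f f]
      restr_idems_commute[OF equalizing_idem_props(1)[OF f f] restr_idems_Rest[OF f]] by simp
qed

text \<open>Where \<open>f\<close> agrees with \<open>g\<close> and \<open>g\<close> with
  \<open>h\<close>, also \<open>f\<close> agrees with \<open>h\<close>; commuting the two
  idempotents allows each equation to be used on the overlap.\<close>

lemma local_atlas_equalizing_idem:
  "local_atlas C A (partial_isos C A B) (equalizing_idem C A)"
proof -
  have "equalizing_idem C A g h \<cdot> equalizing_idem C A f g \<sqsubseteq> equalizing_idem C A f h"
    if f: "f \<in> Hom C A B" and g: "g \<in> Hom C A B" and h: "h \<in> Hom C A B" for f g h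
  proof -
    let ?a = "equalizing_idem C A f g" and ?b = "equalizing_idem C A g h"
    have a: "?a \<in> restr_idems C A" and b: "?b \<in> restr_idems C A"
      using equalizing_idem_props(1) f g h by auto
    note aH = restr_idems_Hom[OF a] and bH = restr_idems_Hom[OF b]
    note c = restr_idems_commute[OF b a]
    have "f \<cdot> (?b \<cdot> ?a) = (f \<cdot> ?a) \<cdot> ?b"
      using c f aH bH by (simp add: Hom_def)
    also have "\<dots> = (g \<cdot> ?a) \<cdot> ?b" using equalizing_idem_props(3)[OF f g] by simp
    also have "\<dots> = (g \<cdot> ?b) \<cdot> ?a" using c g aH bH by (simp add: Hom_def)
    also have "\<dots> = (h \<cdot> ?b) \<cdot> ?a" using equalizing_idem_props(3)[OF g h] by simp
    also have "\<dots> = h \<cdot> (?b \<cdot> ?a)" using h aH bH by (simp add: Hom_def)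
    finally have eq: "f \<cdot> (?b \<cdot> ?a) = h \<cdot> (?b \<cdot> ?a)" .
    have "Rest C f \<cdot> (?a \<cdot> ?b) = ?a \<cdot> ?b"
      using Comp_reassoc[OF equalizing_idem_absorb(1)[OF f g], of ?b] f aH bH
      by (simp add: Hom_def)
    moreover have "Rest C h \<cdot> (?b \<cdot> ?a) = ?b \<cdot> ?a"
      using Comp_reassoc[OF equalizing_idem_absorb(2)[OF g h], of ?a] h aH bH
      by (simp add: Hom_def)
    ultimately have "equalizing_idem C A f h \<cdot> (?b \<cdot> ?a) = ?b \<cdot> ?a"
      using eq f h a b c by (intro equalizing_idem_greatest restr_idems_Comp) auto
    then show ?thesis
      using restr_idems_Comp[OF b a] by (simp add: restr_le_def restr_idems_def)
  qed
  then show ?thesis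
    unfolding local_atlas_def
    using equalizing_idem_props(1) equalizing_idem_commute partial_isos_Hom by metis
qed

end

section \<open>The source-target span of the Haefliger groupoid\<close>

text \<open>Glueings are determined only up to isomorphism, so an arbitrary one is fixed and the
  results hold for every choice.\<close>

locale haefliger_span = join_restriction_category C
  for C :: "('o, 'm, 'z) restr_cat_scheme" (structure) +
  fixes A B P :: 'o and \<sigma> :: 'm and q s :: "'m \<Rightarrow> 'm"
  assumes A_Ob: "A \<in> Ob C" and B_Ob: "B \<in> Ob C" and source: "haefliger_source C A B P \<sigma> q s"
begin

abbreviation "\<tau> \<equiv> haefliger_target C A B P s"

section \<open>The source map and its sections\<close>

lemma P_Ob: "P \<in> Ob C"
  and source_local_homeo: "\<sigma> \<in> local_homeos C P A"
  and source_Hom: "\<sigma> \<in> Hom C P A"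
  and source_total: "total C \<sigma>"
  and source_join: "is_join C P A (q ` partial_isos C A B) \<sigma>"
  using source by (auto simp: haefliger_source_def glueing_def local_homeos_def)

lemma section_inverse: "f \<in> partial_isos C A B \<Longrightarrow> partial_inverse C P A (q f) (s f)"
  and piece_section:
    "\<lbrakk>f \<in> partial_isos C A B; g \<in> partial_isos C A B\<rbrakk> \<Longrightarrow> q g \<cdot> s f = equalizing_idem C A f g"
  using source by (auto simp: haefliger_source_def glueing_def)

lemma section_props:
  assumes "f \<in> partial_isos C A B"
  shows "q f \<in> Hom C P A" "s f \<in> Hom C A P" "s f \<cdot> q f = Rest C (q f)" "q f \<cdot> s f = Rest C f"
    "Rest C (s f) = Rest C f" "Rest C f \<cdot> q f = q f"
proof -
  note i = section_inverse[OF assms]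
  show "q f \<in> Hom C P A" "s f \<in> Hom C A P" "s f \<cdot> q f = Rest C (q f)"
    using i by (auto simp: partial_inverse_def)
  \<comment> \<open>The diagonal entry of the atlas at \<open>f\<close> is \<open>Rest C f\<close>,
    so the glueing condition fixes the domain of the section.\<close>
  show 1: "q f \<cdot> s f = Rest C f"
    using piece_section[OF assms assms] equalizing_idem_self partial_isos_Hom[OF assms] by simp
  then show 2: "Rest C (s f) = Rest C f" using i by (simp add: partial_inverse_def)
  show "Rest C f \<cdot> q f = q f" using partial_inverse_absorb(2)[OF i] 2 by simp
qed

lemma source_piece: "f \<in> partial_isos C A B \<Longrightarrow> \<sigma> \<cdot> Rest C (q f) = q f"
  using is_join_piece[OF source_join] by simp

lemma Rest_piece_section:
  assumes "f \<in> partial_isos C A B"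
  shows "Rest C (q f) \<cdot> s f = s f"
  using partial_inverse_absorb(2)[OF partial_inverse_sym[OF section_inverse[OF assms]]] .

lemma source_section:
  assumes "f \<in> partial_isos C A B"
  shows "\<sigma> \<cdot> s f = Rest C f"
  using Comp_reassoc[OF source_piece[OF assms], of "s f"] Rest_piece_section[OF assms]
    section_props[OF assms] source_Hom
  by (simp add: Hom_def)

section \<open>Construction of the target map\<close>

text \<open>On the overlap of the pieces of \<open>f\<close> and \<open>g\<close>, the source lands
  in the region where \<open>f\<close> and \<open>g\<close> agree. This is the compatibility needed
  to join the maps \<open>f \<cdot> q f\<close> into a target map.\<close>

lemma target_pieces_eq:
  assumes f: "f \<in> partial_isos C A B" and g: "g \<in> partial_isos C A B"
  shows "(f \<cdot> q f) \<cdot> Rest C (q g) = (g \<cdot> q g) \<cdot> Rest C (q f)"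
proof -
  note F = section_props[OF f] partial_isos_Hom[OF f]
    and G = section_props[OF g] partial_isos_Hom[OF g]
  let ?E = "equalizing_idem C A f g"
  have E: "?E \<in> restr_idems C A" "f \<cdot> ?E = g \<cdot> ?E"
    using equalizing_idem_props F G by auto
  note EH = restr_idems_Hom[OF E(1)]
  \<comment> \<open>Write \<open>Rest C (q f)\<close> as \<open>s f \<cdot> q f\<close> and apply
    the glueing condition to \<open>q g \<cdot> s f\<close>.\<close>
  have w: "q g \<cdot> Rest C (q f) = ?E \<cdot> q f"
    using F G Comp_reassoc[OF piece_section[OF f g], of "q f"] by (simp add: Hom_def)
  have "q f \<cdot> Rest C (q g) = q g \<cdot> Rest C (q f)"
    using is_join_compatible[OF source_join, of "q f" "q g"] f g by (simp add: compatible_def)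
  then have "(f \<cdot> q f) \<cdot> Rest C (q g) = f \<cdot> (?E \<cdot> q f)" using w F G by (simp add: Hom_def)
  also have "\<dots> = g \<cdot> (?E \<cdot> q f)"
    using EH F G Comp_reassoc[OF E(2), of "q f"] by (simp add: Hom_def)
  also have "\<dots> = (g \<cdot> q g) \<cdot> Rest C (q f)" using w F G by (simp add: Hom_def)
  finally show ?thesis .
qed

text \<open>The image of \<open>q f\<close> lies in the domain of \<open>f\<close>, so nothing is
  lost on composing.\<close>

lemma Rest_target_piece:
  assumes "f \<in> partial_isos C A B"
  shows "Rest C (f \<cdot> q f) = Rest C (q f)"
  using section_props[OF assms] partial_isos_Hom[OF assms] Rest_Rest_Comp[of "q f" f]
  by (simp add: Hom_def)

text \<open>The witness is the join of the maps \<open>f \<cdot> q f\<close>. Its pieces have the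
  same domains as those of \<sigma>, so it inherits totality from \<sigma>.\<close>

lemma target_exists:
  "\<exists>t. is_join C P B ((\<lambda>f. f \<cdot> q f) ` partial_isos C A B) t \<and> total C t \<and>
       (\<forall>f \<in> partial_isos C A B. t \<cdot> s f = f)"
proof -
  let ?F = "(\<lambda>f. f \<cdot> q f) ` partial_isos C A B"
  have F: "?F \<subseteq> Hom C P B"
    using section_props(1) partial_isos_Hom Comp_Hom by blast
  have "compatible C u v" if "u \<in> ?F" "v \<in> ?F" for u v
    using that target_pieces_eq Rest_target_piece by (auto simp: compatible_def)
  then obtain t where t: "is_join C P B ?F t"
    using join_exists[OF P_Ob B_Ob F] by blast
  have tH: "t \<in> Hom C P B" using t by (simp add: is_join_def)
  have "Rest C ` ?F = Rest C ` q ` partial_isos C A B"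
    using Rest_target_piece by (auto simp: image_image)
  then have "Rest C t = Rest C \<sigma>"
    using is_join_Rest[OF t] is_join_Rest[OF source_join] is_join_unique by metis
  then have tot: "total C t" using source_total source_Hom tH by (simp add: total_def Hom_def)
  have "t \<cdot> s f = f" if f: "f \<in> partial_isos C A B" for f
  proof -
    note p = section_props[OF f] partial_isos_Hom[OF f]
    have "t \<cdot> Rest C (q f) = f \<cdot> q f"
      using is_join_piece[OF t, of "f \<cdot> q f"] f Rest_target_piece[OF f] by simp
    then have "(t \<cdot> Rest C (q f)) \<cdot> s f = (f \<cdot> q f) \<cdot> s f" by simp
    then show ?thesis using p tH Rest_piece_section[OF f] by (simp add: Hom_def)
  qed
  then show ?thesis using t tot by blast
qed

text \<open>The pieces \<open>q f\<close> cover \<open>P\<close>, and on each of them a map is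
  determined by its composite with \<open>s f\<close>, because
  \<open>Rest C (q f) = s f \<cdot> q f\<close>.\<close>

lemma target_unique:
  assumes "t \<in> Hom C P B" "u \<in> Hom C P B"
    and "\<And>f. f \<in> partial_isos C A B \<Longrightarrow> t \<cdot> s f = f" "\<And>f. f \<in> partial_isos C A B \<Longrightarrow> u \<cdot> s f = f"
  shows "t = u"
proof (rule eq_on_total_join[OF source_join source_total assms(1,2)])
  fix k assume "k \<in> q ` partial_isos C A B"
  then obtain f where f: "f \<in> partial_isos C A B" "k = q f" by auto
  note p = section_props[OF f(1)]
  have "v \<cdot> Rest C (q f) = f \<cdot> q f" if "v \<in> Hom C P B" "v \<cdot> s f = f" for v
    using p that Comp_reassoc[OF that(2), of "q f"] by (simp add: Hom_def)
  then show "t \<cdot> Rest C k = u \<cdot> Rest C k" using assms f by simp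
qed

text \<open>Existence and uniqueness make the definite description in
  \<open>haefliger_target\<close> denote the join just constructed.\<close>

lemma target_props:
  shows target_join: "is_join C P B ((\<lambda>f. f \<cdot> q f) ` partial_isos C A B) \<tau>"
    and target_total: "total C \<tau>"
    and target_section: "f \<in> partial_isos C A B \<Longrightarrow> \<tau> \<cdot> s f = f"
proof -
  obtain t where t: "is_join C P B ((\<lambda>f. f \<cdot> q f) ` partial_isos C A B) t" "total C t"
    "\<And>f. f \<in> partial_isos C A B \<Longrightarrow> t \<cdot> s f = f"
    using target_exists by blast
  have "\<tau> = t"
    unfolding haefliger_target_def
    by (rule the_equality) (use t target_unique[of _ t] in \<open>auto simp: is_join_def\<close>)
  then show "is_join C P B ((\<lambda>f. f \<cdot> q f) ` partial_isos C A B) \<tau>" "total C \<tau>"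
    "f \<in> partial_isos C A B \<Longrightarrow> \<tau> \<cdot> s f = f"
    using t by auto
qed

lemma target_Hom: "\<tau> \<in> Hom C P B"
  using target_join by (simp add: is_join_def)

lemma target_local_homeo: "\<tau> \<in> local_homeos C P B"
proof -
  have "f \<cdot> q f \<in> partial_isos C P B" if "f \<in> partial_isos C A B" for f
  proof (rule partial_isos_Comp[OF _ that])
    show "q f \<in> partial_isos C P A" using section_inverse[OF that] by (auto simp: partial_isos_def)
  qed
  then have "(\<lambda>f. f \<cdot> q f) ` partial_isos C A B \<subseteq> partial_isos C P B" by blast
  then show ?thesis
    using target_join target_total target_Hom by (auto simp: local_homeos_def)
qed

section \<open>Joint monicity of source and target\<close>

text \<open>The glueing condition writes the idempotent as \<open>q g \<cdot> s f\<close>. Then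
  \<open>s g \<cdot> q g\<close> is a restriction idempotent, which \<open>R4\<close> moves past
  \<open>s f\<close>.\<close>

lemma sections_agree:
  assumes f: "f \<in> partial_isos C A B" and g: "g \<in> partial_isos C A B"
  shows "s f \<cdot> equalizing_idem C A f g = s g \<cdot> equalizing_idem C A f g"
proof -
  note F = section_props[OF f] and G = section_props[OF g]
  let ?E = "equalizing_idem C A f g"
  have E: "Rest C ?E = ?E"
    using equalizing_idem_props(1)[OF partial_isos_Hom[OF f] partial_isos_Hom[OF g]]
    by (simp add: restr_idems_def)
  have "s g \<cdot> ?E = (s g \<cdot> q g) \<cdot> s f"
    using F(1,2) G(1,2) by (simp add: Hom_def flip: piece_section[OF f g])
  also have "\<dots> = s f \<cdot> Rest C (q g \<cdot> s f)"
    using F G Rest_Comp_eq[of "s f" "q g"] by (simp add: Hom_def)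
  also have "\<dots> = s f \<cdot> ?E" using piece_section[OF f g] E by simp
  finally show ?thesis by simp
qed

text \<open>A partial inverse \<open>v\<close> of \<open>w\<close> turns the equations along
  \<open>w\<close> into equations on the idempotent \<open>Rest C v\<close>, the image of
  \<open>w\<close>. This puts the image inside the region where \<open>f\<close> and
  \<open>g\<close> agree.\<close>

lemma sections_eq:
  assumes f: "f \<in> partial_isos C A B" and g: "g \<in> partial_isos C A B"
    and w: "w \<in> partial_isos C X A"
    and fw: "Rest C f \<cdot> w = w" and gw: "Rest C g \<cdot> w = w" and eq: "f \<cdot> w = g \<cdot> w"
  shows "s f \<cdot> w = s g \<cdot> w"
proof -
  note F = section_props[OF f] partial_isos_Hom[OF f]
    and G = section_props[OF g] partial_isos_Hom[OF g]
  obtain v where v: "partial_inverse C X A w v" using w by (auto simp: partial_isos_def)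
  have wH: "w \<in> Hom C X A" and vH: "v \<in> Hom C A X" and wv: "w \<cdot> v = Rest C v"
    using v by (auto simp: partial_inverse_def)
  let ?E = "equalizing_idem C A f g"
  have E: "?E \<in> Hom C A A" using equalizing_idem_props(1) F G restr_idems_Hom by blast
  \<comment> \<open>Composing an equation along \<open>w\<close> with \<open>v\<close> yields the
    corresponding equation on \<open>Rest C v\<close>.\<close>
  have cancel: "x \<cdot> Rest C v = (x \<cdot> w) \<cdot> v" if "x \<in> Hom C A Y" for x Y
    using that wH vH wv by (simp add: Hom_def)
  have rf: "Rest C f \<in> Hom C A A" "Rest C g \<in> Hom C A A" using F G by (auto simp: Hom_def)
  have "?E \<cdot> Rest C v = Rest C v"
    using F G cancel[of f] cancel[of g] cancel[OF rf(1)] cancel[OF rf(2)] fw gw eq wv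
    by (intro equalizing_idem_greatest restr_idems_Rest[OF vH]) auto
  then have "?E \<cdot> w = w"
    using Comp_reassoc[of ?E "Rest C v" _ w] partial_inverse_absorb(2)[OF v] wH vH E
    by (simp add: Hom_def)
  then show ?thesis
    using Comp_reassoc[OF sections_agree[OF f g], of w] wH E F G
    by (simp add: Hom_def)
qed

text \<open>A map landing in the piece of \<open>f\<close> is recovered from its source alone, by
  applying the section \<open>s f\<close>.\<close>

lemma factor_piece:
  assumes f: "f \<in> partial_isos C A B" and h: "h \<in> Hom C X P" and "Rest C (q f) \<cdot> h = h"
  shows "h = s f \<cdot> (\<sigma> \<cdot> h)" "Rest C f \<cdot> (\<sigma> \<cdot> h) = \<sigma> \<cdot> h" "\<tau> \<cdot> h = f \<cdot> (\<sigma> \<cdot> h)"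
proof -
  note F = section_props[OF f] partial_isos_Hom[OF f]
  have qh: "q f \<cdot> h = \<sigma> \<cdot> h"
    using Comp_reassoc[OF source_piece[OF f], of h] assms source_Hom F
    by (simp add: Hom_def)
  show 1: "h = s f \<cdot> (\<sigma> \<cdot> h)"
    using assms F Comp_reassoc[OF F(3), of h] by (simp add: Hom_def flip: qh)
  show "Rest C f \<cdot> (\<sigma> \<cdot> h) = \<sigma> \<cdot> h"
    using h F Comp_reassoc[OF F(6), of h] by (simp add: Hom_def flip: qh)
  have "\<tau> \<cdot> (s f \<cdot> (\<sigma> \<cdot> h)) = f \<cdot> (\<sigma> \<cdot> h)"
    using h F target_Hom source_Hom by (intro Comp_reassoc target_section f) (auto simp: Hom_def)
  then show "\<tau> \<cdot> h = f \<cdot> (\<sigma> \<cdot> h)"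
    using 1 by simp
qed

text \<open>Cut \<open>X\<close> into the parts where \<open>h\<close> lands in the piece of some
  \<open>f\<close> and \<open>k\<close> in the piece of some \<open>g\<close>. There
  \<open>factor_piece\<close> reduces the claim to \<open>sections_eq\<close>, which is why the
  common source must be a partial isomorphism.\<close>

lemma source_target_monic:
  assumes h: "h \<in> Hom C X P" and k: "k \<in> Hom C X P"
    and \<sigma>_eq: "\<sigma> \<cdot> h = \<sigma> \<cdot> k" and \<tau>_eq: "\<tau> \<cdot> h = \<tau> \<cdot> k"
    and iso: "\<sigma> \<cdot> h \<in> partial_isos C X A"
  shows "h = k"
proof -
  have cover: "is_join C X A ((\<lambda>u. u \<cdot> x) ` q ` partial_isos C A B) (\<sigma> \<cdot> x)"
    if "x \<in> Hom C X P" for x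
    using is_join_Comp_right[OF source_join that] .
  have local_eq: "(h \<cdot> Rest C (q f \<cdot> h)) \<cdot> Rest C (q g \<cdot> k) = (k \<cdot> Rest C (q f \<cdot> h)) \<cdot> Rest C (q g \<cdot> k)"
    if f: "f \<in> partial_isos C A B" and g: "g \<in> partial_isos C A B" for f g
  proof -
    note F = section_props(1)[OF f] and G = section_props(1)[OF g]
    let ?d = "Rest C (q f \<cdot> h)" and ?e = "Rest C (q g \<cdot> k)"
    let ?h = "(h \<cdot> ?d) \<cdot> ?e" and ?k = "(k \<cdot> ?d) \<cdot> ?e"
    have hk: "?h \<in> Hom C X P" "?k \<in> Hom C X P" using F G h k by (auto simp: Hom_def)
    have "Rest C (q f) \<cdot> h = h \<cdot> ?d" "Rest C (q g) \<cdot> k = k \<cdot> ?e"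
      using Rest_Comp_eq[of h "q f"] Rest_Comp_eq[of k "q g"] F G h k by (auto simp: Hom_def)
    moreover have k': "?k = (k \<cdot> ?e) \<cdot> ?d"
      using F G h k Rest_commute[of "q f \<cdot> h" "q g \<cdot> k"] by (simp add: Hom_def)
    moreover have "Rest C (q f) \<cdot> ?h = (Rest C (q f) \<cdot> h) \<cdot> (?d \<cdot> ?e)"
      using F G h k by (simp add: Hom_def)
    moreover have "Rest C (q g) \<cdot> ((k \<cdot> ?e) \<cdot> ?d) = (Rest C (q g) \<cdot> k) \<cdot> (?e \<cdot> ?d)"
      using F G h k by (simp add: Hom_def)
    ultimately have "Rest C (q f) \<cdot> ?h = ?h" "Rest C (q g) \<cdot> ?k = ?k"
      using F G h k Rest_Comp_self_left[of "q f \<cdot> h" ?e] Rest_Comp_self_left[of "q g \<cdot> k" ?d]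
      by (simp_all add: Hom_def)
    note Fh = factor_piece[OF f hk(1) this(1)] and Gk = factor_piece[OF g hk(2) this(2)]
    have assoc: "x \<cdot> ((y \<cdot> ?d) \<cdot> ?e) = ((x \<cdot> y) \<cdot> ?d) \<cdot> ?e"
      if "y \<in> Hom C X P" "x \<in> Hom C P Z" for x y Z
      using that F G h k by (simp add: Hom_def)
    have \<sigma>hk: "\<sigma> \<cdot> ?h = \<sigma> \<cdot> ?k" using assoc h k source_Hom \<sigma>_eq by simp
    have \<tau>hk: "\<tau> \<cdot> ?h = \<tau> \<cdot> ?k" using assoc h k target_Hom \<tau>_eq by simp
    have "((\<sigma> \<cdot> h) \<cdot> ?d) \<cdot> ?e \<in> partial_isos C X A"
      using F G h k by (intro partial_isos_Comp_Rest[where Z = A] iso) (auto simp: Hom_def)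
    then have "\<sigma> \<cdot> ?h \<in> partial_isos C X A" using assoc[OF h source_Hom] by simp
    then have "s f \<cdot> (\<sigma> \<cdot> ?h) = s g \<cdot> (\<sigma> \<cdot> ?h)"
      using Fh Gk \<sigma>hk \<tau>hk by (intro sections_eq[OF f g]) auto
    then show ?thesis using Fh(1) Gk(1) \<sigma>hk by metis
  qed
  \<comment> \<open>With \<open>f\<close> fixed, the pieces of \<open>k\<close> are glued first; the
    pieces of \<open>h\<close> follow afterwards. Totality of \<sigma> identifies the domain so
    covered with the domain of \<open>h\<close> and \<open>k\<close>.\<close>
  have "h \<cdot> Rest C (q f \<cdot> h) = k \<cdot> Rest C (q f \<cdot> h)" if f: "f \<in> partial_isos C A B" for f
  proof -
    let ?d = "Rest C (q f \<cdot> h)"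
    note F = section_props(1)[OF f]
    have hd: "h \<cdot> ?d \<in> Hom C X P" "k \<cdot> ?d \<in> Hom C X P" using F h k by (auto simp: Hom_def)
    have "(h \<cdot> ?d) \<cdot> Rest C (\<sigma> \<cdot> k) = (k \<cdot> ?d) \<cdot> Rest C (\<sigma> \<cdot> k)"
      using local_eq[OF f] by (intro eq_on_join[OF cover[OF k] hd]) auto
    moreover have "Rest C (\<sigma> \<cdot> k) = Rest C k" "Rest C (\<sigma> \<cdot> k) = Rest C h"
      using Rest_Comp_total[of k \<sigma>] Rest_Comp_total[of h \<sigma>] source_Hom source_total h k \<sigma>_eq
      by (auto simp: Hom_def)
    moreover have "(x \<cdot> ?d) \<cdot> Rest C x = x \<cdot> ?d" if "x \<in> Hom C X P" for x
      using that F h Rest_commute[of "q f \<cdot> h" x] by (simp add: Hom_def)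
    ultimately show ?thesis
      using h k by metis
  qed
  then have "h \<cdot> Rest C (\<sigma> \<cdot> h) = k \<cdot> Rest C (\<sigma> \<cdot> h)"
    by (intro eq_on_join[OF cover[OF h] h k]) auto
  moreover have "Rest C (\<sigma> \<cdot> h) = Rest C h" "Rest C (\<sigma> \<cdot> h) = Rest C k"
    using Rest_Comp_total[of h \<sigma>] Rest_Comp_total[of k \<sigma>] source_Hom source_total h k \<sigma>_eq
    by (auto simp: Hom_def)
  ultimately show ?thesis
    using R1[OF h] R1[OF k] by metis
qed

section \<open>Lifting pairs of local homeomorphisms\<close>

text \<open>The partial isomorphism \<open>\<beta> \<cdot> \<alpha>'\<close> from \<open>A\<close>
  to \<open>B\<close> carries the image of \<alpha> to that of \<beta>; its section composed with
  \<alpha> is the lift.\<close>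

lemma local_lift:
  assumes \<alpha>: "\<alpha> \<in> partial_isos C X A" and \<beta>: "\<beta> \<in> partial_isos C X B" and R: "Rest C \<alpha> = Rest C \<beta>"
  shows "\<exists>h \<in> partial_isos C X P. \<sigma> \<cdot> h = \<alpha> \<and> \<tau> \<cdot> h = \<beta>"
proof -
  obtain \<alpha>' where i: "partial_inverse C X A \<alpha> \<alpha>'" using \<alpha> by (auto simp: partial_isos_def)
  have H: "\<alpha> \<in> Hom C X A" "\<alpha>' \<in> Hom C A X" "\<beta> \<in> Hom C X B" and e: "\<alpha>' \<cdot> \<alpha> = Rest C \<alpha>"
    using i \<beta> partial_isos_Hom by (auto simp: partial_inverse_def)
  have "\<alpha>' \<in> partial_isos C A X" using partial_inverse_sym[OF i] by (auto simp: partial_isos_def)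
  then have f: "\<beta> \<cdot> \<alpha>' \<in> partial_isos C A B" by (rule partial_isos_Comp[OF _ \<beta>])
  let ?f = "\<beta> \<cdot> \<alpha>'"
  note F = section_props[OF f] partial_isos_Hom[OF f]
  have "Rest C \<alpha> \<cdot> \<alpha>' = \<alpha>'" using partial_inverse_absorb(2)[OF partial_inverse_sym[OF i]] .
  \<comment> \<open>Equality of the domains of \<alpha> and \<beta> enters here: the domain of
    \<open>?f\<close> is the whole image of \<alpha>, so \<open>\<sigma> \<cdot> s ?f\<close> fixes
    \<alpha>.\<close>
  then have "Rest C ?f = Rest C \<alpha>'"
    using H R Rest_Rest_Comp[of \<alpha>' \<beta>] by (simp add: Hom_def)
  then have "\<sigma> \<cdot> (s ?f \<cdot> \<alpha>) = \<alpha>"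
    using Comp_reassoc[OF source_section[OF f], of \<alpha>] H F(1-2) source_Hom
      partial_inverse_absorb(2)[OF i]
    by (simp add: Hom_def)
  moreover have "\<tau> \<cdot> (s ?f \<cdot> \<alpha>) = \<beta>"
  proof -
    have "\<tau> \<cdot> (s ?f \<cdot> \<alpha>) = ?f \<cdot> \<alpha>"
      using H F(1-2) target_Hom by (intro Comp_reassoc target_section f) (auto simp: Hom_def)
    also have "\<dots> = \<beta>" using H e R by (simp add: Hom_def)
    finally show ?thesis .
  qed
  moreover have "s ?f \<cdot> \<alpha> \<in> partial_isos C X P"
    using partial_inverse_sym[OF section_inverse[OF f]] \<alpha>
    by (intro partial_isos_Comp[OF \<alpha>]) (auto simp: partial_isos_def)
  ultimately show ?thesis by blast
qed

text \<open>The source composite is covered by partial isomorphisms, and over each of them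
  \<open>source_target_monic\<close> applies.\<close>

lemma lift_unique:
  assumes a: "\<sigma> \<cdot> h \<in> local_homeos C X A" and h: "h \<in> Hom C X P" and k: "k \<in> Hom C X P"
    and eq: "\<sigma> \<cdot> h = \<sigma> \<cdot> k" "\<tau> \<cdot> h = \<tau> \<cdot> k"
  shows "h = k"
proof -
  obtain F where F: "F \<subseteq> partial_isos C X A" "is_join C X A F (\<sigma> \<cdot> h)" "total C (\<sigma> \<cdot> h)"
    using a by (auto simp: local_homeos_def)
  show ?thesis
  proof (rule eq_on_total_join[OF F(2,3) h k])
    fix \<alpha> assume \<alpha>: "\<alpha> \<in> F"
    then have \<alpha>H: "\<alpha> \<in> Hom C X A" using F(1) partial_isos_Hom by blast
    have assoc: "x \<cdot> (y \<cdot> Rest C \<alpha>) = (x \<cdot> y) \<cdot> Rest C \<alpha>"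
      if "y \<in> Hom C X P" "x \<in> Hom C P Z" for x y Z
      using that \<alpha>H by (simp add: Hom_def)
    show "h \<cdot> Rest C \<alpha> = k \<cdot> Rest C \<alpha>"
    proof (rule source_target_monic[where X = X])
      show "h \<cdot> Rest C \<alpha> \<in> Hom C X P" "k \<cdot> Rest C \<alpha> \<in> Hom C X P"
        using h k \<alpha>H by (auto simp: Hom_def)
      show "\<sigma> \<cdot> (h \<cdot> Rest C \<alpha>) = \<sigma> \<cdot> (k \<cdot> Rest C \<alpha>)" "\<tau> \<cdot> (h \<cdot> Rest C \<alpha>) = \<tau> \<cdot> (k \<cdot> Rest C \<alpha>)"
        using assoc h k source_Hom target_Hom eq by simp_all
      show "\<sigma> \<cdot> (h \<cdot> Rest C \<alpha>) \<in> partial_isos C X A"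
        using assoc[OF h source_Hom] is_join_piece[OF F(2) \<alpha>] F(1) \<alpha> by auto
    qed
  qed
qed

text \<open>On the common domain both maps lie over the same restrictions of \<open>a\<close> and
  \<open>b\<close>, so joint monicity identifies them there.\<close>

lemma local_lifts_compatible:
  assumes a: "a \<in> Hom C X A" and b: "b \<in> Hom C X B"
    and h: "h \<in> Hom C X P" "\<sigma> \<cdot> h = a \<cdot> Rest C h" "\<tau> \<cdot> h = b \<cdot> Rest C h"
    and k: "k \<in> Hom C X P" "\<sigma> \<cdot> k = a \<cdot> Rest C k" "\<tau> \<cdot> k = b \<cdot> Rest C k"
    and iso: "\<sigma> \<cdot> h \<in> partial_isos C X A"
  shows "compatible C h k"
proof -
  note hH = h(1) and kH = k(1)
  have c: "Rest C h \<cdot> Rest C k = Rest C k \<cdot> Rest C h"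
    using Rest_commute[of h k] hH kH by (simp add: Hom_def)
  have assoc: "(x \<cdot> h) \<cdot> Rest C k = x \<cdot> (h \<cdot> Rest C k)" if "x \<in> Hom C P Z" for x Z
    using that hH kH by (simp add: Hom_def)
  have eq: "x \<cdot> (h \<cdot> Rest C k) = x \<cdot> (k \<cdot> Rest C h)"
    if x: "x \<in> Hom C P Z" and y: "y \<in> Hom C X Z" "x \<cdot> h = y \<cdot> Rest C h" "x \<cdot> k = y \<cdot> Rest C k"
    for x y Z
  proof -
    have "x \<cdot> (h \<cdot> Rest C k) = (y \<cdot> Rest C h) \<cdot> Rest C k" using assoc[OF x] y(2) by simp
    also have "\<dots> = (y \<cdot> Rest C k) \<cdot> Rest C h" using y(1) hH kH c by (simp add: Hom_def)
    also have "\<dots> = (x \<cdot> k) \<cdot> Rest C h" using y(3) by simp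
    also have "\<dots> = x \<cdot> (k \<cdot> Rest C h)" using x hH kH by (simp add: Hom_def)
    finally show ?thesis .
  qed
  show ?thesis
    unfolding compatible_def
  proof (rule source_target_monic[where X = X])
    show "h \<cdot> Rest C k \<in> Hom C X P" "k \<cdot> Rest C h \<in> Hom C X P"
      using hH kH by (auto simp: Hom_def)
    show "\<sigma> \<cdot> (h \<cdot> Rest C k) = \<sigma> \<cdot> (k \<cdot> Rest C h)" by (rule eq[OF source_Hom a h(2) k(2)])
    show "\<tau> \<cdot> (h \<cdot> Rest C k) = \<tau> \<cdot> (k \<cdot> Rest C h)" by (rule eq[OF target_Hom b h(3) k(3)])
    show "\<sigma> \<cdot> (h \<cdot> Rest C k) \<in> partial_isos C X A"
      using partial_isos_Comp_Rest[OF iso kH] assoc[OF source_Hom] by simp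
  qed
qed

lemma lift_exists:
  assumes a: "a \<in> local_homeos C X A" and b: "b \<in> local_homeos C X B"
  shows "\<exists>h \<in> local_homeos C X P. \<sigma> \<cdot> h = a \<and> \<tau> \<cdot> h = b"
proof -
  obtain F G where F: "F \<subseteq> partial_isos C X A" "is_join C X A F a" "total C a"
    and G: "G \<subseteq> partial_isos C X B" "is_join C X B G b" "total C b"
    and ab: "a \<in> Hom C X A" "b \<in> Hom C X B"
    using a b by (auto simp: local_homeos_def)
  \<comment> \<open>All partial lifts are joined at once, so no choice of lifts is needed; the
    condition on \<open>\<sigma> \<cdot> h\<close> is what joint monicity asks for.\<close>
  define L where "L = {h \<in> partial_isos C X P. \<sigma> \<cdot> h \<in> partial_isos C X A \<and>
    \<sigma> \<cdot> h = a \<cdot> Rest C h \<and> \<tau> \<cdot> h = b \<cdot> Rest C h}"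
  have LH: "L \<subseteq> Hom C X P" using partial_isos_Hom by (auto simp: L_def)
  have X: "X \<in> Ob C" using Hom_Ob[OF ab(1)] by simp
  have "compatible C h k" if "h \<in> L" "k \<in> L" for h k
    using that LH by (intro local_lifts_compatible[OF ab]) (auto simp: L_def)
  then obtain h where h: "is_join C X P L h"
    using join_exists[OF X P_Ob LH] by blast
  have hH: "h \<in> Hom C X P" using h by (simp add: is_join_def)
  note IdX = Id_Hom[OF X]
  have RhH: "Rest C h \<in> Hom C X X" using hH by (simp add: Hom_def)
  \<comment> \<open>Towards totality of \<open>h\<close>: its domain contains every overlap of a
    piece of \<open>a\<close> with a piece of \<open>b\<close>. The identity is kept explicit to
    match \<open>eq_on_total_join\<close>, applied below first over \<open>G\<close> and then over
    \<open>F\<close>.\<close>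
  have cover: "(Id C X \<cdot> Rest C \<alpha>) \<cdot> Rest C \<beta> = (Rest C h \<cdot> Rest C \<alpha>) \<cdot> Rest C \<beta>"
    if \<alpha>: "\<alpha> \<in> F" and \<beta>: "\<beta> \<in> G" for \<alpha> \<beta>
  proof -
    have pi: "\<alpha> \<in> partial_isos C X A" "\<beta> \<in> partial_isos C X B" using \<alpha> \<beta> F G by auto
    note H = partial_isos_Hom[OF pi(1)] partial_isos_Hom[OF pi(2)]
    let ?d = "Rest C \<alpha> \<cdot> Rest C \<beta>"
    have c: "?d = Rest C \<beta> \<cdot> Rest C \<alpha>" using Rest_commute[of \<alpha> \<beta>] H by (simp add: Hom_def)
    \<comment> \<open>Cutting each piece down to the domain of the other gives the common domain
      that \<open>local_lift\<close> demands.\<close>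
    have "Rest C (\<alpha> \<cdot> Rest C \<beta>) = Rest C (\<beta> \<cdot> Rest C \<alpha>)" using c H by (simp add: Hom_def)
    then obtain l where l: "l \<in> partial_isos C X P" "\<sigma> \<cdot> l = \<alpha> \<cdot> Rest C \<beta>" "\<tau> \<cdot> l = \<beta> \<cdot> Rest C \<alpha>"
      using local_lift[of "\<alpha> \<cdot> Rest C \<beta>" X "\<beta> \<cdot> Rest C \<alpha>"] partial_isos_Comp_Rest pi H by blast
    note lH = partial_isos_Hom[OF l(1)]
    have Rl: "Rest C l = ?d"
      using Rest_Comp_total[of l \<sigma>] source_total source_Hom lH l(2) H by (simp add: Hom_def)
    have "\<alpha> \<cdot> Rest C \<beta> = (a \<cdot> Rest C \<alpha>) \<cdot> Rest C \<beta>" using is_join_piece[OF F(2) \<alpha>] by simp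
    moreover have "\<beta> \<cdot> Rest C \<alpha> = (b \<cdot> Rest C \<beta>) \<cdot> Rest C \<alpha>" using is_join_piece[OF G(2) \<beta>] by simp
    ultimately have "\<sigma> \<cdot> l = a \<cdot> Rest C l" "\<tau> \<cdot> l = b \<cdot> Rest C l"
      using l Rl c ab H by (auto simp: Hom_def)
    moreover have "\<sigma> \<cdot> l \<in> partial_isos C X A"
      using l(2) partial_isos_Comp_Rest[OF pi(1) H(2)] by simp
    ultimately have "l \<in> L" using l by (simp add: L_def)
    then have "h \<cdot> Rest C l = l" by (rule is_join_piece[OF h])
    then have "Rest C h \<cdot> Rest C l = Rest C l"
      using Rest_Comp_Rest[of l h] lH hH by (simp add: Hom_def)
    then show ?thesis using Rl H hH X by (simp add: Hom_def)
  qed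
  have "Id C X \<cdot> Rest C \<alpha> = Rest C h \<cdot> Rest C \<alpha>" if \<alpha>: "\<alpha> \<in> F" for \<alpha>
  proof (rule eq_on_total_join[OF G(2,3) _ _ cover[OF \<alpha>]])
    have "\<alpha> \<in> Hom C X A" using \<alpha> F(1) partial_isos_Hom by blast
    then show "Id C X \<cdot> Rest C \<alpha> \<in> Hom C X X" "Rest C h \<cdot> Rest C \<alpha> \<in> Hom C X X"
      using IdX hH by (auto simp: Hom_def)
  qed
  then have "Id C X = Rest C h"
    by (rule eq_on_total_join[OF F(2,3) IdX RhH])
  then have tot: "total C h" using hH by (simp add: total_def Hom_def)
  have piece: "(x \<cdot> h) \<cdot> Rest C l = x \<cdot> l" if "x \<in> Hom C P Z" "l \<in> L" for x l Z
  proof -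
    have "(x \<cdot> h) \<cdot> Rest C l = x \<cdot> (h \<cdot> Rest C l)" using that hH LH by (auto simp: Hom_def)
    then show ?thesis using is_join_piece[OF h that(2)] by simp
  qed
  have "\<sigma> \<cdot> h = a"
    by (rule eq_on_total_join[OF h tot Comp_Hom[OF hH source_Hom] ab(1)])
      (use piece[OF source_Hom] in \<open>simp add: L_def\<close>)
  moreover have "\<tau> \<cdot> h = b"
    by (rule eq_on_total_join[OF h tot Comp_Hom[OF hH target_Hom] ab(2)])
      (use piece[OF target_Hom] in \<open>simp add: L_def\<close>)
  moreover have "L \<subseteq> partial_isos C X P" by (auto simp: L_def)
  then have "h \<in> local_homeos C X P"
    using h hH tot by (auto simp: local_homeos_def)
  ultimately show ?thesis by blast
qed

lemma is_product_haefliger_span: "is_product (Lh C) A B P \<sigma> \<tau>"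
proof -
  \<comment> \<open>This turns the universal property in \<open>Lh C\<close> into a statement about
    local homeomorphisms of \<open>C\<close>.\<close>
  have Hom_Lh: "Hom (Lh C) X Y = local_homeos C X Y" for X Y
    by (auto simp: Hom_def Lh_def local_homeos_def)
  have Lh: "Ob (Lh C) = Ob C" "Comp (Lh C) = Comp C" by (simp_all add: Lh_def)
  have "\<exists>!h. h \<in> local_homeos C X P \<and> \<sigma> \<cdot> h = a \<and> \<tau> \<cdot> h = b"
    if a: "a \<in> local_homeos C X A" and b: "b \<in> local_homeos C X B" for X a b
  proof -
    obtain h where h: "h \<in> local_homeos C X P" "\<sigma> \<cdot> h = a" "\<tau> \<cdot> h = b"
      using lift_exists[OF a b] by blast
    moreover have "k = h" if "k \<in> local_homeos C X P" "\<sigma> \<cdot> k = a" "\<tau> \<cdot> k = b" for k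
      using lift_unique[of k X h] that h a by (auto simp: local_homeos_def)
    ultimately show ?thesis by blast
  qed
  then show ?thesis
    using A_Ob B_Ob P_Ob source_local_homeo target_local_homeo
    by (simp add: is_product_def Hom_Lh Lh)
qed

end

theorem proposition8p4:
  fixes C :: "('o, 'm) restr_cat" and small :: "'m set \<Rightarrow> bool" and A B :: 'o
  assumes "join_restriction_category C"
    and "smallness small"
    and "locally_small small C"
    and "has_local_glueings small C"
    and "A \<in> Ob C" and "B \<in> Ob C"
  shows "(\<exists>P \<sigma> q s. haefliger_source C A B P \<sigma> q s) \<and>
         (\<forall>P \<sigma> q s. haefliger_source C A B P \<sigma> q s \<longrightarrow>
            is_product (Lh C) A B P \<sigma> (haefliger_target C A B P s))"
proof -
  interpret join_restriction_category C by fact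
  \<comment> \<open>The index set of the atlas must be small before a glueing can be requested; it
    inherits smallness from the hom-set.\<close>
  have "partial_isos C A B \<lesssim> Hom C A B"
    using partial_isos_Hom by (intro subset_imp_lepoll) blast
  then have "small (partial_isos C A B)"
    using assms unfolding smallness_def locally_small_def by blast
  then have "\<exists>P \<sigma> q s. haefliger_source C A B P \<sigma> q s"
    unfolding haefliger_source_def
    using assms(4,5) local_atlas_equalizing_idem unfolding has_local_glueings_def by blast
  moreover have "is_product (Lh C) A B P \<sigma> (haefliger_target C A B P s)"
    if "haefliger_source C A B P \<sigma> q s" for P \<sigma> q s
  proof -
    interpret haefliger_span C A B P \<sigma> q s
      by unfold_locales (use that assms in auto)
    show ?thesis by (rule is_product_haefliger_span)
  qed
  ultimately show ?thesis by blast
qed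

end
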